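(* Let $\mathcal H$ be a finite-dimensional complex Hilbert space, $V\in\mathcal B(\mathcal H)$ with $\|V\|_{\mathrm{HS}}=1$, and $\lambda>0$. If the map $\mathrm{Tr}-4\lambda\,\mathrm{Ad}_V$ on $\mathcal B(\mathcal H)$ is $1$-positive (i.e. positive), then the map $(\mathrm{Tr}-\lambda\,\mathrm{Ad}_V)^{\otimes2}$ on $\mathcal B(\mathcal H\otimes\mathcal H)$ is $2$-positive.
   Context: $\mathrm{Ad}_V(x)=VxV^*$; $\mathrm{Tr}-\mu\,\mathrm{Ad}_V$ denotes the map $x\mapsto\mathrm{Tr}(x)\mathbf 1-\mu VxV^*$ on $\mathcal B(\mathcal H)$. $\|V\|_{\mathrm{HS}}^2=\mathrm{Tr}(VV^* )$. A linear map $\phi$ is $k$-positive if $\phi\otimes\mathrm{id}_{M_k(\mathbb C)}$ maps positive semidefinite operators to positive semidefinite operators. *)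

theory Defs
  imports "HOL-Analysis.Analysis"
begin

text \<open>
  A finite-dimensional complex Hilbert space with a fixed orthonormal basis indexed by a finite
  type 'n is \<^typ>\<open>complex^'n\<close>, and its operators are the matrices \<^typ>\<open>complex^'n^'n\<close>.
  The tensor product of the spaces indexed by 'n and 'm is indexed by 'n \<times> 'm.
\<close>

definition cinner :: "complex^'n \<Rightarrow> complex^'n \<Rightarrow> complex" where
  "cinner x y = (\<Sum>i\<in>UNIV. cnj (x $ i) * y $ i)"

definition adj :: "complex^'n^'m \<Rightarrow> complex^'m^'n" where
  "adj A = map_matrix cnj (transpose A)"

definition psd :: "complex^'n^'n \<Rightarrow> bool" where
  "psd A \<longleftrightarrow> adj A = A \<and> (\<forall>x. 0 \<le> Re (cinner x (A *v x)))"

definition hs_norm :: "complex^'n^'n \<Rightarrow> real" where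
  "hs_norm V = sqrt (Re (trace (V ** adj V)))"

text \<open>Multiplication of matrices by complex scalars; the library only provides real scalars.\<close>

definition mscale :: "complex \<Rightarrow> complex^'n^'m \<Rightarrow> complex^'n^'m" where
  "mscale c A = map_matrix (\<lambda>a. c * a) A"

lemma vector_space_mscale: "vector_space mscale"
  by unfold_locales (simp_all add: mscale_def vec_eq_iff algebra_simps)

definition complex_linear :: "(complex^'n^'n \<Rightarrow> complex^'m^'m) \<Rightarrow> bool" where
  "complex_linear \<phi> \<longleftrightarrow> Vector_Spaces.linear mscale mscale \<phi>"

definition kron :: "complex^'n^'n \<Rightarrow> complex^'m^'m \<Rightarrow> complex^('n \<times> 'm)^('n \<times> 'm)" where
  "kron A B = (\<chi> p q. A $ fst p $ fst q * B $ snd p $ snd q)"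

definition mat_unit :: "'n \<Rightarrow> 'n \<Rightarrow> complex^'n^'n" where
  "mat_unit i j = (\<chi> a b. if a = i \<and> b = j then 1 else 0)"

text \<open>
  The tensor product of two linear maps. An operator on the tensor product space is
  \<open>X = (\<Sum>i j k l. X\<^bsub>(i,k),(j,l)\<^esub> (E\<^bsub>ij\<^esub> \<otimes> E\<^bsub>kl\<^esub>))\<close>, which forces the formula below. The lemmas
  \<open>linear_tensor_map\<close>, \<open>tensor_map_kron\<close> and \<open>tensor_map_unique\<close> confirm that it is the unique
  linear map with \<open>A \<otimes> B \<mapsto> \<phi> A \<otimes> \<psi> B\<close>.
\<close>

definition tensor_map ::
  "(complex^'n^'n \<Rightarrow> complex^'p^'p) \<Rightarrow> (complex^'m^'m \<Rightarrow> complex^'q^'q)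
    \<Rightarrow> complex^('n \<times> 'm)^('n \<times> 'm) \<Rightarrow> complex^('p \<times> 'q)^('p \<times> 'q)" where
  "tensor_map \<phi> \<psi> X = (\<Sum>i\<in>UNIV. \<Sum>j\<in>UNIV. \<Sum>k\<in>UNIV. \<Sum>l\<in>UNIV.
     mscale (X $ (i, k) $ (j, l)) (kron (\<phi> (mat_unit i j)) (\<psi> (mat_unit k l))))"

definition positive_map :: "(complex^'n^'n \<Rightarrow> complex^'m^'m) \<Rightarrow> bool" where
  "positive_map \<phi> \<longleftrightarrow> complex_linear \<phi> \<and> (\<forall>X. psd X \<longrightarrow> psd (\<phi> X))"

text \<open>
  The integer k is the cardinality of the index type 'k; thus k-positivity for k = 1, 2 is
  obtained with the numeral types of the same names.
\<close>

definition k_positive :: "'k::finite itself \<Rightarrow> (complex^'n^'n \<Rightarrow> complex^'m^'m) \<Rightarrow> bool" where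
  "k_positive _ \<phi> \<longleftrightarrow> complex_linear \<phi> \<and>
     positive_map (tensor_map \<phi> (id :: complex^'k^'k \<Rightarrow> complex^'k^'k))"

definition Ad :: "complex^'n^'n \<Rightarrow> complex^'n^'n \<Rightarrow> complex^'n^'n" where
  "Ad V x = V ** x ** adj V"

definition trace_minus_Ad :: "real \<Rightarrow> complex^'n^'n \<Rightarrow> complex^'n^'n \<Rightarrow> complex^'n^'n" where
  "trace_minus_Ad \<mu> V x = mat (trace x) - mscale (of_real \<mu>) (Ad V x)"

lemma mscale_nth [simp]: "mscale c A $ i $ j = c * A $ i $ j"
  by (simp add: mscale_def)

lemma kron_nth [simp]: "kron A B $ p $ q = A $ fst p $ fst q * B $ snd p $ snd q"
  by (simp add: kron_def)

lemma mat_unit_nth [simp]: "mat_unit i j $ a $ b = (if a = i \<and> b = j then 1 else 0)"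
  by (simp add: mat_unit_def)

lemma complex_linear_iff:
  "complex_linear \<phi> \<longleftrightarrow> (\<forall>A B. \<phi> (A + B) = \<phi> A + \<phi> B) \<and> (\<forall>c A. \<phi> (mscale c A) = mscale c (\<phi> A))"
  by (auto simp: complex_linear_def Vector_Spaces.linear_iff vector_space_mscale)

lemma complex_linear_sum:
  assumes "complex_linear \<phi>"
  shows "\<phi> (\<Sum>i\<in>S. f i) = (\<Sum>i\<in>S. \<phi> (f i))"
  using assms Vector_Spaces.linear.axioms(3) module_hom.sum unfolding complex_linear_def
  by blast

lemma mat_expand:
  "A = (\<Sum>i\<in>UNIV. \<Sum>j\<in>UNIV. mscale (A $ i $ j) (mat_unit i j))"
proof -
  have "(\<Sum>i\<in>UNIV. \<Sum>j\<in>UNIV. A $ i $ j * (if a = i \<and> b = j then 1 else 0)) = A $ a $ b" for a b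
  proof -
    have "(\<Sum>i\<in>UNIV. \<Sum>j\<in>UNIV. A $ i $ j * (if a = i \<and> b = j then 1 else 0))
        = (\<Sum>i\<in>UNIV. if a = i then (\<Sum>j\<in>UNIV. if b = j then A $ i $ j else 0) else 0)"
      by (intro sum.cong refl) (auto intro!: sum.cong simp del: sum.delta sum.delta')
    then show ?thesis by simp
  qed
  then show ?thesis by (simp add: vec_eq_iff)
qed

lemma linear_tensor_map: "complex_linear (tensor_map \<phi> \<psi>)"
  by (simp add: complex_linear_iff tensor_map_def vec_eq_iff sum.distrib[symmetric]
      sum_distrib_left distrib_right mult.assoc)

lemma tensor_map_kron:
  assumes "complex_linear \<phi>" "complex_linear \<psi>"
  shows "tensor_map \<phi> \<psi> (kron A B) = kron (\<phi> A) (\<psi> B)"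
proof -
  have expand: "\<theta> C = (\<Sum>i\<in>UNIV. \<Sum>j\<in>UNIV. mscale (C $ i $ j) (\<theta> (mat_unit i j)))"
    if "complex_linear \<theta>" for \<theta> :: "complex^'x^'x \<Rightarrow> complex^'y^'y" and C
    by (subst mat_expand[of C]) (use that in \<open>simp add: complex_linear_sum complex_linear_iff\<close>)
  have "tensor_map \<phi> \<psi> (kron A B) $ p $ q = kron (\<phi> A) (\<psi> B) $ p $ q" for p q
  proof -
    have "kron (\<phi> A) (\<psi> B) $ p $ q
        = (\<Sum>i\<in>UNIV. \<Sum>j\<in>UNIV. A $ i $ j * \<phi> (mat_unit i j) $ fst p $ fst q)
        * (\<Sum>k\<in>UNIV. \<Sum>l\<in>UNIV. B $ k $ l * \<psi> (mat_unit k l) $ snd p $ snd q)"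
      by (subst expand[OF assms(1)], subst expand[OF assms(2)]) simp
    also have "\<dots> = (\<Sum>i\<in>UNIV. \<Sum>j\<in>UNIV. \<Sum>k\<in>UNIV. \<Sum>l\<in>UNIV.
          (A $ i $ j * \<phi> (mat_unit i j) $ fst p $ fst q)
        * (B $ k $ l * \<psi> (mat_unit k l) $ snd p $ snd q))"
      unfolding sum_distrib_right unfolding sum_distrib_left ..
    also have "\<dots> = tensor_map \<phi> \<psi> (kron A B) $ p $ q"
      by (simp add: tensor_map_def mult_ac)
    finally show ?thesis by simp
  qed
  then show ?thesis by (simp add: vec_eq_iff)
qed

lemma tensor_map_unique:
  fixes \<phi> :: "complex^'a^'a \<Rightarrow> complex^'b^'b" and \<psi> :: "complex^'c^'c \<Rightarrow> complex^'d^'d"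
  assumes "complex_linear \<phi>" "complex_linear \<psi>" "complex_linear \<Theta>"
    and "\<And>A B. \<Theta> (kron A B) = kron (\<phi> A) (\<psi> B)"
  shows "\<Theta> = tensor_map \<phi> \<psi>"
proof
  fix X
  have unit: "mat_unit p q = kron (mat_unit (fst p) (fst q)) (mat_unit (snd p) (snd q))" for p q
    by (auto simp: vec_eq_iff prod_eq_iff)
  have unit_eq: "\<Theta> (mat_unit p q) = tensor_map \<phi> \<psi> (mat_unit p q)" for p q
    by (subst (1 2) unit) (simp add: assms tensor_map_kron)
  have sumX: "\<theta> X = (\<Sum>p\<in>UNIV. \<Sum>q\<in>UNIV. mscale (X $ p $ q) (\<theta> (mat_unit p q)))"
    if "complex_linear \<theta>" for \<theta> :: "complex^('a \<times> 'c)^('a \<times> 'c) \<Rightarrow> complex^('b \<times> 'd)^('b \<times> 'd)"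
    by (subst mat_expand[of X]) (use that in \<open>simp add: complex_linear_sum complex_linear_iff\<close>)
  show "\<Theta> X = tensor_map \<phi> \<psi> X"
    unfolding sumX[OF assms(3)] sumX[OF linear_tensor_map] unit_eq ..
qed

end

theory Submission
  imports Defs
begin

text \<open>
  Positivity of \<open>Tr - 4 r Ad\<^sub>V\<close> says \<open>4 r \<parallel>V x\<parallel>\<^sup>2 \<le> \<parallel>x\<parallel>\<^sup>2\<close>. Expanding,
  \<open>(Tr - r Ad\<^sub>V) \<otimes> (Tr - r Ad\<^sub>V)\<close> is
  \<open>1/2 Tr \<otimes> (Tr - 2 r Ad\<^sub>V) + 1/2 (Tr - 2 r Ad\<^sub>V) \<otimes> Tr + r\<^sup>2 Ad\<^sub>V \<otimes> Ad\<^sub>V\<close>,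
  whose last term is completely positive. Tested on rank-one operators, 2-positivity of the first two
  terms says that contracting one leg of a tensor \<open>W\<close> of rank at most two with \<open>V\<close> satisfies
  \<open>2 r \<parallel>V \<cdot> W\<parallel>\<^sup>2 \<le> \<parallel>W\<parallel>\<^sup>2\<close>. Writing \<open>W = a \<otimes> b + a' \<otimes> b'\<close> with \<open>a\<close> orthogonal to \<open>a'\<close>, each summand
  contracts with norm at most \<open>\<parallel>V\<parallel> \<parallel>a\<parallel> \<parallel>b\<parallel>\<close>, and passing from two orthogonal summands to their sum
  costs a factor 2.
\<close>

section \<open>Contraction of tensors of rank two\<close>

lemma sum_UNIV_prod:
  "(\<Sum>p\<in>UNIV. f p) = (\<Sum>a\<in>UNIV. \<Sum>b\<in>UNIV. f (a, b))"
  for f :: "'a::finite \<times> 'b::finite \<Rightarrow> 'c::comm_monoid_add"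
  by (simp add: sum.cartesian_product split_def UNIV_Times_UNIV)

lemma norm_sum_mult_le:
  fixes f g :: "'a \<Rightarrow> complex"
  shows "(cmod (\<Sum>i\<in>S. f i * g i))\<^sup>2 \<le> (\<Sum>i\<in>S. (cmod (f i))\<^sup>2) * (\<Sum>i\<in>S. (cmod (g i))\<^sup>2)"
proof -
  have "cmod (\<Sum>i\<in>S. f i * g i) \<le> (\<Sum>i\<in>S. cmod (f i) * cmod (g i))"
    by (rule order_trans[OF norm_sum]) (simp add: norm_mult)
  then have "(cmod (\<Sum>i\<in>S. f i * g i))\<^sup>2 \<le> (\<Sum>i\<in>S. cmod (f i) * cmod (g i))\<^sup>2"
    by (rule power_mono) simp
  also have "\<dots> \<le> (\<Sum>i\<in>S. (cmod (f i))\<^sup>2) * (\<Sum>i\<in>S. (cmod (g i))\<^sup>2)"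
    by (rule Cauchy_Schwarz_ineq_sum)
  finally show ?thesis .
qed

lemma norm_add_square_le: "(cmod (z + w))\<^sup>2 \<le> 2 * (cmod z)\<^sup>2 + 2 * (cmod w)\<^sup>2"
proof -
  have "(cmod (z + w))\<^sup>2 \<le> (cmod z + cmod w)\<^sup>2"
    by (rule power_mono[OF norm_triangle_ineq]) simp
  also have "\<dots> \<le> 2 * (cmod z)\<^sup>2 + 2 * (cmod w)\<^sup>2"
    using sum_squares_bound[of "cmod z" "cmod w"] by (simp add: power2_sum)
  finally show ?thesis .
qed

text \<open>Here \<open>c\<close> bounds the squared operator norm of \<open>V\<close>. For fixed
  \<open>q\<close> and \<open>j\<close>, Cauchy-Schwarz in \<open>p\<close> separates
  \<open>a\<close> from \<open>V\<close> applied to the vector \<open>b (., j)\<close>, to which the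
  bound applies. Summing over \<open>q\<close> and \<open>j\<close> then factorizes.\<close>

lemma contraction_product_le:
  fixes V :: "'p::finite \<Rightarrow> 'i::finite \<Rightarrow> complex"
    and a :: "'p \<times> 'q::finite \<Rightarrow> complex" and b :: "'i \<times> 'j::finite \<Rightarrow> complex"
  assumes V: "\<And>x. (\<Sum>p\<in>UNIV. (cmod (\<Sum>i\<in>UNIV. V p i * x i))\<^sup>2) \<le> c * (\<Sum>i\<in>UNIV. (cmod (x i))\<^sup>2)"
  shows "(\<Sum>q\<in>UNIV. \<Sum>j\<in>UNIV. (cmod (\<Sum>p\<in>UNIV. \<Sum>i\<in>UNIV. a (p, q) * b (i, j) * V p i))\<^sup>2)
    \<le> c * ((\<Sum>P\<in>UNIV. (cmod (a P))\<^sup>2) * (\<Sum>I\<in>UNIV. (cmod (b I))\<^sup>2))"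
proof -
  have "(cmod (\<Sum>p\<in>UNIV. \<Sum>i\<in>UNIV. a (p, q) * b (i, j) * V p i))\<^sup>2
      \<le> (\<Sum>p\<in>UNIV. (cmod (a (p, q)))\<^sup>2) * (c * (\<Sum>i\<in>UNIV. (cmod (b (i, j)))\<^sup>2))" for q j
  proof -
    have "(\<Sum>p\<in>UNIV. \<Sum>i\<in>UNIV. a (p, q) * b (i, j) * V p i)
        = (\<Sum>p\<in>UNIV. a (p, q) * (\<Sum>i\<in>UNIV. V p i * b (i, j)))"
      by (simp add: sum_distrib_left mult_ac)
    then have "(cmod (\<Sum>p\<in>UNIV. \<Sum>i\<in>UNIV. a (p, q) * b (i, j) * V p i))\<^sup>2
        \<le> (\<Sum>p\<in>UNIV. (cmod (a (p, q)))\<^sup>2) * (\<Sum>p\<in>UNIV. (cmod (\<Sum>i\<in>UNIV. V p i * b (i, j)))\<^sup>2)"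
      by (simp add: norm_sum_mult_le)
    also have "\<dots> \<le> (\<Sum>p\<in>UNIV. (cmod (a (p, q)))\<^sup>2) * (c * (\<Sum>i\<in>UNIV. (cmod (b (i, j)))\<^sup>2))"
      by (intro mult_left_mono V sum_nonneg) simp
    finally show ?thesis .
  qed
  then have "(\<Sum>q\<in>UNIV. \<Sum>j\<in>UNIV. (cmod (\<Sum>p\<in>UNIV. \<Sum>i\<in>UNIV. a (p, q) * b (i, j) * V p i))\<^sup>2)
      \<le> (\<Sum>q\<in>UNIV. \<Sum>j\<in>UNIV. (\<Sum>p\<in>UNIV. (cmod (a (p, q)))\<^sup>2) * (c * (\<Sum>i\<in>UNIV. (cmod (b (i, j)))\<^sup>2)))"
    by (intro sum_mono)
  also have "\<dots> = c * ((\<Sum>q\<in>UNIV. \<Sum>p\<in>UNIV. (cmod (a (p, q)))\<^sup>2)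
      * (\<Sum>j\<in>UNIV. \<Sum>i\<in>UNIV. (cmod (b (i, j)))\<^sup>2))"
  proof -
    have "(\<Sum>q\<in>UNIV. \<Sum>j\<in>UNIV. f q * (c * g j)) = c * ((\<Sum>q\<in>UNIV. f q) * (\<Sum>j\<in>UNIV. g j))"
      for f :: "'q \<Rightarrow> real" and g :: "'j \<Rightarrow> real"
      by (simp only: sum_product) (simp only: sum_distrib_left mult.left_commute)
    then show ?thesis .
  qed
  also have "\<dots> = c * ((\<Sum>P\<in>UNIV. (cmod (a P))\<^sup>2) * (\<Sum>I\<in>UNIV. (cmod (b I))\<^sup>2))"
    using sum.swap[of "\<lambda>q p. (cmod (a (p, q)))\<^sup>2" UNIV UNIV] sum.swap[of "\<lambda>j i. (cmod (b (i, j)))\<^sup>2" UNIV UNIV]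
    by (simp add: sum_UNIV_prod)
  finally show ?thesis .
qed

text \<open>Pythagoras: the cross terms add up to twice the real part of a product of two inner
  products, the first of which vanishes.\<close>

lemma norm_orthogonal_rank_two:
  fixes a a' :: "'p::finite \<Rightarrow> complex" and b b' :: "'i::finite \<Rightarrow> complex"
  assumes "(\<Sum>P\<in>UNIV. a P * cnj (a' P)) = 0"
  shows "(\<Sum>P\<in>UNIV. \<Sum>I\<in>UNIV. (cmod (a P * b I + a' P * b' I))\<^sup>2)
    = (\<Sum>P\<in>UNIV. (cmod (a P))\<^sup>2) * (\<Sum>I\<in>UNIV. (cmod (b I))\<^sup>2)
    + (\<Sum>P\<in>UNIV. (cmod (a' P))\<^sup>2) * (\<Sum>I\<in>UNIV. (cmod (b' I))\<^sup>2)"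
proof -
  have expand: "(cmod (a P * b I + a' P * b' I))\<^sup>2
      = (cmod (a P))\<^sup>2 * (cmod (b I))\<^sup>2 + (cmod (a' P))\<^sup>2 * (cmod (b' I))\<^sup>2
      + 2 * Re (a P * cnj (a' P) * (b I * cnj (b' I)))" for P I
  proof -
    have "(cmod (z + w))\<^sup>2 = (cmod z)\<^sup>2 + (cmod w)\<^sup>2 + 2 * Re (z * cnj w)" for z w
      by (simp only: cmod_power2) (simp add: power2_eq_square algebra_simps)
    from this[of "a P * b I" "a' P * b' I"] show ?thesis
      by (simp only: norm_mult power_mult_distrib complex_cnj_mult mult_ac)
  qed
  have "(\<Sum>P\<in>UNIV. \<Sum>I\<in>UNIV. 2 * Re (a P * cnj (a' P) * (b I * cnj (b' I))))
      = 2 * Re ((\<Sum>P\<in>UNIV. a P * cnj (a' P)) * (\<Sum>I\<in>UNIV. b I * cnj (b' I)))"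
    unfolding sum_product by (simp only: Re_sum sum_distrib_left)
  also have "\<dots> = 0"
    unfolding assms by simp
  finally show ?thesis
    by (simp only: expand sum.distrib sum_product add_0_right)
qed

text \<open>For orthogonal \<open>a\<close> and \<open>a'\<close>, the factor 2 comes from squaring
  a sum of two terms, and Pythagoras turns the two separate bounds back into the norm of
  \<open>W\<close>. Gram-Schmidt reduces every other case to this one.\<close>

lemma contraction_rank_two_le:
  fixes V :: "'p::finite \<Rightarrow> 'i::finite \<Rightarrow> complex"
    and a a' :: "'p \<times> 'q::finite \<Rightarrow> complex" and b b' :: "'i \<times> 'j::finite \<Rightarrow> complex"
  assumes V: "\<And>x. (\<Sum>p\<in>UNIV. (cmod (\<Sum>i\<in>UNIV. V p i * x i))\<^sup>2) \<le> c * (\<Sum>i\<in>UNIV. (cmod (x i))\<^sup>2)"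
    and W: "\<And>P I. W P I = a P * b I + a' P * b' I"
  shows "(\<Sum>q\<in>UNIV. \<Sum>j\<in>UNIV. (cmod (\<Sum>p\<in>UNIV. \<Sum>i\<in>UNIV. W (p, q) (i, j) * V p i))\<^sup>2)
    \<le> 2 * c * (\<Sum>P\<in>UNIV. \<Sum>I\<in>UNIV. (cmod (W P I))\<^sup>2)"
proof -
  have orthogonal: ?thesis
    if orth: "(\<Sum>P\<in>UNIV. a P * cnj (a' P)) = 0" and W: "\<And>P I. W P I = a P * b I + a' P * b' I"
    for a a' b b'
  proof -
    have "(\<Sum>q\<in>UNIV. \<Sum>j\<in>UNIV. (cmod (\<Sum>p\<in>UNIV. \<Sum>i\<in>UNIV. W (p, q) (i, j) * V p i))\<^sup>2)
        \<le> (\<Sum>q\<in>UNIV. \<Sum>j\<in>UNIV. 2 * (cmod (\<Sum>p\<in>UNIV. \<Sum>i\<in>UNIV. a (p, q) * b (i, j) * V p i))\<^sup>2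
            + 2 * (cmod (\<Sum>p\<in>UNIV. \<Sum>i\<in>UNIV. a' (p, q) * b' (i, j) * V p i))\<^sup>2)"
      by (intro sum_mono) (simp only: W distrib_right sum.distrib norm_add_square_le)
    also have "\<dots> \<le> 2 * (c * ((\<Sum>P\<in>UNIV. (cmod (a P))\<^sup>2) * (\<Sum>I\<in>UNIV. (cmod (b I))\<^sup>2)))
        + 2 * (c * ((\<Sum>P\<in>UNIV. (cmod (a' P))\<^sup>2) * (\<Sum>I\<in>UNIV. (cmod (b' I))\<^sup>2)))"
      unfolding sum.distrib sum_distrib_left[symmetric]
      by (intro add_mono mult_left_mono contraction_product_le V) auto
    also have "\<dots> = 2 * c * (\<Sum>P\<in>UNIV. \<Sum>I\<in>UNIV. (cmod (W P I))\<^sup>2)"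
      unfolding W norm_orthogonal_rank_two[OF orth] by (simp add: algebra_simps)
    finally show ?thesis .
  qed
  show ?thesis
  proof (cases "(\<Sum>P\<in>UNIV. a P * cnj (a P)) = 0")
    \<comment> \<open>A vector of norm zero vanishes, so it is already orthogonal to
      \<open>a'\<close>.\<close>
    case True
    then have "complex_of_real (\<Sum>P\<in>UNIV. (cmod (a P))\<^sup>2) = 0"
      by (simp add: complex_norm_square del: of_real_power)
    then have "a P = 0" for P
      by (cases P) (simp add: sum_nonneg_eq_0_iff del: of_real_sum)
    then show ?thesis
      using orthogonal[of a a' b b', OF _ W] by simp
  next
    case False
    \<comment> \<open>The Gram-Schmidt coefficient that makes \<open>a' - k a\<close> orthogonal to
      \<open>a\<close>. The tensor is unchanged when \<open>k b'\<close> is moved into the first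
      summand: it equals \<open>a\<close> times \<open>b + k b'\<close> plus \<open>a' - k a\<close>
      times \<open>b'\<close>.\<close>
    define k where "k = (\<Sum>P\<in>UNIV. cnj (a P) * a' P) / cnj (\<Sum>P\<in>UNIV. a P * cnj (a P))"
    have "(\<Sum>P\<in>UNIV. a P * cnj (a' P - k * a P))
        = (\<Sum>P\<in>UNIV. a P * cnj (a' P)) - cnj k * (\<Sum>P\<in>UNIV. a P * cnj (a P))"
      by (simp add: algebra_simps sum_subtractf sum_distrib_left)
    also have "\<dots> = 0"
      using False by (simp add: k_def)
    finally show ?thesis
      by (rule orthogonal[where b = "\<lambda>I. b I + k * b' I" and b' = b']) (simp add: W algebra_simps)
  qed
qed

section \<open>Positive semidefinite matrices\<close>

definition outer :: "complex^'n \<Rightarrow> complex^'n^'n" where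
  "outer x = (\<chi> i j. x $ i * cnj (x $ j))"

lemma outer_nth [simp]: "outer x $ i $ j = x $ i * cnj (x $ j)"
  by (simp add: outer_def)

lemma adj_nth [simp]: "adj A $ i $ j = cnj (A $ j $ i)"
  by (simp add: adj_def transpose_def)

lemma cinner_mult_vec:
  "cinner x (A *v y) = (\<Sum>i\<in>UNIV. \<Sum>j\<in>UNIV. cnj (x $ i) * A $ i $ j * y $ j)"
  by (simp add: cinner_def matrix_vector_mult_def sum_distrib_left mult.assoc)

lemma cinner_add_left: "cinner (x + y) z = cinner x z + cinner y z"
  and cinner_add_right: "cinner z (x + y) = cinner z x + cinner z y"
  and cinner_scale_left: "cinner (c *s x) z = cnj c * cinner x z"
  and cinner_scale_right: "cinner z (c *s x) = c * cinner z x"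
  by (simp_all add: cinner_def algebra_simps sum.distrib sum_distrib_left)

lemma cinner_axis_left: "cinner (axis i 1) z = z $ i"
proof -
  have "cinner (axis i 1) z = (\<Sum>k\<in>UNIV. if k = i then z $ k else 0)"
    unfolding cinner_def by (intro sum.cong) (auto simp: axis_def)
  then show ?thesis by simp
qed

lemma mult_vec_axis: "(A *v axis i 1) $ j = A $ j $ i" for A :: "complex^'n^'m"
proof -
  have "(A *v axis i 1) $ j = (\<Sum>k\<in>UNIV. if k = i then A $ j $ k else 0)"
    unfolding matrix_vector_mult_def by (auto simp: axis_def intro!: sum.cong simp del: sum.delta sum.delta')
  then show ?thesis by simp
qed

lemma cinner_outer: "cinner z (outer x *v z) = of_real ((cmod (cinner z x))\<^sup>2)"
  unfolding cinner_mult_vec complex_norm_square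
  by (simp add: cinner_def sum_product mult_ac)

lemma psd_0: "psd 0"
  by (simp add: psd_def vec_eq_iff cinner_def)

lemma psd_outer: "psd (outer x)"
  by (simp add: psd_def vec_eq_iff cinner_outer)

lemma psd_add: "psd A \<Longrightarrow> psd B \<Longrightarrow> psd (A + B)"
  by (simp add: psd_def vec_eq_iff matrix_vector_mult_add_rdistrib cinner_add_right)

lemma hermitian_form:
  assumes "adj A = A"
  shows "cinner y (A *v x) = cnj (cinner x (A *v y))"
proof -
  have "cnj (A $ i $ j) = A $ j $ i" for i j
    using assms by (metis adj_nth)
  then show ?thesis
    unfolding cinner_mult_vec by (subst sum.swap) (simp add: mult_ac)
qed

text \<open>Viewing the form as a real quadratic polynomial in \<open>c\<close> permits completing
  the square along one coordinate direction.\<close>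

lemma hermitian_form_add_axis:
  assumes "adj A = A"
  shows "Re (cinner (x + c *s axis i 1) (A *v (x + c *s axis i 1)))
    = Re (cinner x (A *v x)) + 2 * Re (cnj c * (A *v x) $ i) + (cmod c)\<^sup>2 * Re (A $ i $ i)"
proof -
  have "cinner x (A *v axis i 1) = cnj ((A *v x) $ i)"
    by (subst hermitian_form[OF assms]) (simp add: cinner_axis_left)
  then have "cinner (x + c *s axis i 1) (A *v (x + c *s axis i 1))
      = cinner x (A *v x) + (cnj c * (A *v x) $ i + cnj (cnj c * (A *v x) $ i))
      + c * cnj c * A $ i $ i"
    by (simp add: matrix_vector_right_distrib vector_scalar_commute cinner_add_left cinner_add_right
        cinner_scale_left cinner_scale_right cinner_axis_left mult_vec_axis algebra_simps)
  then show ?thesis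
    by (simp add: complex_add_cnj complex_norm_square[symmetric] del: of_real_power)
qed

lemma psd_diag:
  assumes "psd A"
  shows "0 \<le> Re (A $ i $ i)" "Im (A $ i $ i) = 0"
proof -
  show "0 \<le> Re (A $ i $ i)"
    using assms unfolding psd_def by (metis cinner_axis_left mult_vec_axis)
  have "cnj (A $ i $ i) = A $ i $ i"
    using assms by (metis adj_nth psd_def)
  then show "Im (A $ i $ i) = 0"
    by (simp add: complex_eq_iff)
qed

text \<open>With zero diagonal, the form at \<open>axis j 1 + c *s axis i 1\<close> has no term
  quadratic in \<open>c\<close>. The choice \<open>c = - A $ i $ j\<close> makes it negative unless
  that entry vanishes.\<close>

lemma psd_zero_diag:
  assumes "psd A" and "\<And>i. A $ i $ i = 0"
  shows "A = 0"
proof -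
  have "A $ i $ j = 0" for i j
  proof -
    have "0 \<le> Re (cinner (axis j 1 + (- (A $ i $ j)) *s axis i 1)
        (A *v (axis j 1 + (- (A $ i $ j)) *s axis i 1)))"
      using assms(1) by (simp add: psd_def)
    also have "\<dots> = - 2 * (cmod (A $ i $ j))\<^sup>2"
      using assms unfolding psd_def
      by (subst hermitian_form_add_axis)
        (simp_all add: cinner_axis_left mult_vec_axis cmod_power2, simp add: power2_eq_square)
    finally show ?thesis by simp
  qed
  then show ?thesis by (simp add: vec_eq_iff)
qed

text \<open>Subtracting the rank-one Schur complement at a nonzero diagonal entry clears that entry.\<close>

lemma psd_induct [consumes 1, case_names zero add]:
  fixes A :: "complex^'n^'n"
  assumes "psd A" and zero: "P 0" and add: "\<And>x B. psd B \<Longrightarrow> P B \<Longrightarrow> P (outer x + B)"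
  shows "P A"
  using assms(1)
proof (induction "card {i. A $ i $ i \<noteq> 0}" arbitrary: A rule: less_induct)
  case less
  note herm = less.prems[unfolded psd_def, THEN conjunct1]
  show ?case
  proof (cases "\<forall>i. A $ i $ i = 0")
    case True
    then show ?thesis using psd_zero_diag[OF less.prems] zero by simp
  next
    case False
    then obtain i where i: "A $ i $ i \<noteq> 0" by blast
    define d where "d = Re (A $ i $ i)"
    have d: "d > 0" "A $ i $ i = of_real d"
      using i psd_diag[OF less.prems, of i] by (auto simp: d_def complex_eq_iff)
    \<comment> \<open>Column \<open>i\<close>, scaled so that \<open>outer x\<close> agrees with
      \<open>A\<close> on the whole of row \<open>i\<close> and column \<open>i\<close>.\<close>
    define x where "x = (\<chi> j. A $ j $ i / of_real (sqrt d))"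
    define B where "B = A - outer x"
    have outer_x: "outer x $ j $ k = A $ j $ i * A $ i $ k / of_real d" for j k
    proof -
      have "cnj (A $ k $ i) = A $ i $ k" using herm by (metis adj_nth)
      then show ?thesis
        using d by (simp add: x_def flip: of_real_mult)
    qed
    have "psd B"
      unfolding psd_def
    proof
      have "adj (outer x) = outer x"
        using psd_outer psd_def by blast
      then show "adj B = B"
        using herm by (simp add: B_def vec_eq_iff)
      show "\<forall>z. 0 \<le> Re (cinner z (B *v z))"
      proof
        fix z
        have "cinner z x = cnj ((A *v z) $ i) / of_real (sqrt d)"
        proof -
          have "cinner z (A *v axis i 1) = cnj ((A *v z) $ i)"
            by (subst hermitian_form[OF herm]) (simp add: cinner_axis_left)
          then show ?thesis
            by (simp add: x_def cinner_def mult_vec_axis flip: sum_divide_distrib)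
        qed
        then have "cinner z (outer x *v z) = of_real ((cmod ((A *v z) $ i))\<^sup>2 / d)"
          using d by (simp add: cinner_outer norm_divide power_divide)
        then have "Re (cinner z (B *v z)) = Re (cinner z (A *v z)) - (cmod ((A *v z) $ i))\<^sup>2 / d"
          using cinner_add_right[of z "B *v z" "outer x *v z"]
          by (simp add: B_def flip: matrix_vector_mult_add_rdistrib)
        \<comment> \<open>This multiple of the axis vector minimizes the form of \<open>A\<close>
          along direction \<open>i\<close>; the minimum is exactly the form of \<open>B\<close> at
          \<open>z\<close>.\<close>
        moreover have "0 \<le> Re (cinner (z + (- (A *v z) $ i / of_real d) *s axis i 1)
            (A *v (z + (- (A *v z) $ i / of_real d) *s axis i 1)))"
          using less.prems by (simp add: psd_def)
        moreover have "Re (cnj (- (A *v z) $ i / of_real d) * (A *v z) $ i) = - ((cmod ((A *v z) $ i))\<^sup>2 / d)"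
          using d by (simp only: cmod_power2) (simp add: power2_eq_square add_divide_distrib)
        moreover have "(cmod (- (A *v z) $ i / of_real d))\<^sup>2 * d = (cmod ((A *v z) $ i))\<^sup>2 / d"
          using d by (simp add: norm_divide power_divide power2_eq_square)
        ultimately show "0 \<le> Re (cinner z (B *v z))"
          unfolding hermitian_form_add_axis[OF herm] d_def[symmetric] by linarith
      qed
    qed
    \<comment> \<open>Zero diagonal entries stay zero: \<open>B $ j $ j\<close> is minus a square
      there, yet nonnegative because \<open>B\<close> is psd. Hence the number of nonzero diagonal
      entries strictly drops.\<close>
    have "B $ j $ j = 0" if "A $ j $ j = 0" for j
    proof -
      have "Re (B $ j $ j) = - (cmod (x $ j))\<^sup>2"
        using that by (simp only: cmod_power2) (simp add: B_def power2_eq_square)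
      then have "Re (B $ j $ j) \<le> 0"
        by simp
      then have "Re (B $ j $ j) = 0"
        using psd_diag(1)[OF \<open>psd B\<close>, of j] by (rule antisym)
      then show ?thesis
        using psd_diag(2)[OF \<open>psd B\<close>, of j] by (simp add: complex_eq_iff)
    qed
    moreover have "B $ i $ i = 0"
      using d by (simp add: B_def outer_x del: outer_nth)
    ultimately have "{j. B $ j $ j \<noteq> 0} \<subset> {j. A $ j $ j \<noteq> 0}"
      using i by blast
    then have "card {j. B $ j $ j \<noteq> 0} < card {j. A $ j $ j \<noteq> 0}"
      by (intro psubset_card_mono) auto
    then have "P (outer x + B)"
      using less.hyps \<open>psd B\<close> add by blast
    then show ?thesis by (simp add: B_def)
  qed
qed

section \<open>Testing k-positivity on tensors of bounded rank\<close>

text \<open>Tensoring with \<open>id\<close> acts blockwise: \<open>\<psi>\<close> is applied to the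
  block of \<open>X\<close> indexed by \<open>s\<close> and \<open>t\<close>, expanded in matrix
  units.\<close>

lemma tensor_map_id_nth:
  fixes X :: "complex^('n::finite \<times> 'k::finite)^('n \<times> 'k)"
  shows "tensor_map \<psi> id X $ (p, s) $ (q, t)
    = (\<Sum>i\<in>UNIV. \<Sum>j\<in>UNIV. X $ (i, s) $ (j, t) * \<psi> (mat_unit i j) $ p $ q)"
proof -
  have "tensor_map \<psi> id X $ (p, s) $ (q, t) = (\<Sum>i\<in>UNIV. \<Sum>j\<in>UNIV. \<Sum>k\<in>UNIV. \<Sum>l\<in>UNIV.
      if s = k then if t = l then X $ (i, k) $ (j, l) * \<psi> (mat_unit i j) $ p $ q else 0 else 0)"
    by (auto simp: tensor_map_def intro!: sum.cong simp del: sum.delta sum.delta')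
  also have "\<dots> = (\<Sum>i\<in>UNIV. \<Sum>j\<in>UNIV. \<Sum>k\<in>UNIV.
      if s = k then X $ (i, k) $ (j, t) * \<psi> (mat_unit i j) $ p $ q else 0)"
    by (intro sum.cong refl) simp
  finally show ?thesis by simp
qed

text \<open>The vectors \<open>x\<close> and \<open>y\<close> enter only through \<open>W\<close>, a
  sum of as many product tensors as \<open>'k\<close> has elements. The right side is the quadratic
  form of the Choi matrix of \<open>\<psi>\<close>, so k-positivity becomes a condition on tensors
  of rank at most k.\<close>

lemma tensor_map_id_outer_form:
  fixes y :: "complex^('m::finite \<times> 'k::finite)" and x :: "complex^('n::finite \<times> 'k)"
  defines "W \<equiv> \<lambda>p i. \<Sum>s\<in>UNIV. cnj (y $ (p, s)) * x $ (i, s)"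
  shows "cinner y (tensor_map \<psi> id (outer x) *v y)
    = (\<Sum>p\<in>UNIV. \<Sum>q\<in>UNIV. \<Sum>i\<in>UNIV. \<Sum>j\<in>UNIV. W p i * cnj (W q j) * \<psi> (mat_unit i j) $ p $ q)"
proof -
  let ?t = "\<lambda>p q i j s t. cnj (y $ (p, s)) * x $ (i, s) * (y $ (q, t) * cnj (x $ (j, t)))
    * \<psi> (mat_unit i j) $ p $ q"
  have "cinner y (tensor_map \<psi> id (outer x) *v y) = (\<Sum>p\<in>UNIV. \<Sum>s\<in>UNIV. \<Sum>q\<in>UNIV. \<Sum>t\<in>UNIV.
      \<Sum>i\<in>UNIV. \<Sum>j\<in>UNIV. ?t p q i j s t)"
    unfolding cinner_mult_vec sum_UNIV_prod tensor_map_id_nth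
    by (simp add: sum_distrib_left sum_distrib_right mult_ac)
  \<comment> \<open>The sums over \<open>s\<close> and \<open>t\<close> are moved innermost, where
    they factor into \<open>W p i\<close> and \<open>cnj (W q j)\<close>.\<close>
  also have "\<dots> = (\<Sum>p\<in>UNIV. \<Sum>q\<in>UNIV. \<Sum>s\<in>UNIV. \<Sum>t\<in>UNIV. \<Sum>i\<in>UNIV. \<Sum>j\<in>UNIV. ?t p q i j s t)"
    by (intro sum.cong refl sum.swap)
  also have "\<dots> = (\<Sum>p\<in>UNIV. \<Sum>q\<in>UNIV. \<Sum>i\<in>UNIV. \<Sum>j\<in>UNIV. \<Sum>s\<in>UNIV. \<Sum>t\<in>UNIV. ?t p q i j s t)"
  proof (intro sum.cong refl)
    fix p q
    have "(\<Sum>s\<in>UNIV. \<Sum>t\<in>UNIV. \<Sum>i\<in>UNIV. \<Sum>j\<in>UNIV. ?t p q i j s t)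
        = (\<Sum>s\<in>UNIV. \<Sum>i\<in>UNIV. \<Sum>t\<in>UNIV. \<Sum>j\<in>UNIV. ?t p q i j s t)"
      by (intro sum.cong refl sum.swap)
    also have "\<dots> = (\<Sum>i\<in>UNIV. \<Sum>s\<in>UNIV. \<Sum>t\<in>UNIV. \<Sum>j\<in>UNIV. ?t p q i j s t)"
      by (rule sum.swap)
    also have "\<dots> = (\<Sum>i\<in>UNIV. \<Sum>s\<in>UNIV. \<Sum>j\<in>UNIV. \<Sum>t\<in>UNIV. ?t p q i j s t)"
      by (intro sum.cong refl sum.swap)
    also have "\<dots> = (\<Sum>i\<in>UNIV. \<Sum>j\<in>UNIV. \<Sum>s\<in>UNIV. \<Sum>t\<in>UNIV. ?t p q i j s t)"
      by (intro sum.cong refl sum.swap)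
    finally show "(\<Sum>s\<in>UNIV. \<Sum>t\<in>UNIV. \<Sum>i\<in>UNIV. \<Sum>j\<in>UNIV. ?t p q i j s t)
        = (\<Sum>i\<in>UNIV. \<Sum>j\<in>UNIV. \<Sum>s\<in>UNIV. \<Sum>t\<in>UNIV. ?t p q i j s t)" .
  qed
  finally show ?thesis
    by (simp only: W_def cnj_sum sum_product)
      (simp only: sum_distrib_right complex_cnj_mult complex_cnj_cnj)
qed

text \<open>By \<open>psd_induct\<close> and additivity, rank-one inputs suffice. For these,
  \<open>herm\<close> gives self-adjointness and \<open>form\<close> gives nonnegativity, with
  \<open>a s p = cnj (y $ (p, s))\<close> and \<open>b s i = x $ (i, s)\<close>.\<close>

lemma k_positiveI:
  fixes \<psi> :: "complex^'n^'n \<Rightarrow> complex^'m^'m"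
  assumes lin: "complex_linear \<psi>"
    and herm: "\<And>i j p q. cnj (\<psi> (mat_unit i j) $ p $ q) = \<psi> (mat_unit j i) $ q $ p"
    and form: "\<And>(a :: 'k::finite \<Rightarrow> 'm \<Rightarrow> complex) b W. (\<And>p i. W p i = (\<Sum>s\<in>UNIV. a s p * b s i)) \<Longrightarrow>
      0 \<le> Re (\<Sum>p\<in>UNIV. \<Sum>q\<in>UNIV. \<Sum>i\<in>UNIV. \<Sum>j\<in>UNIV. W p i * cnj (W q j) * \<psi> (mat_unit i j) $ p $ q)"
  shows "k_positive TYPE('k) \<psi>"
  unfolding k_positive_def positive_map_def
proof (intro conjI lin linear_tensor_map allI impI)
  fix X :: "complex^('n \<times> 'k)^('n \<times> 'k)"
  assume "psd X"
  then show "psd (tensor_map \<psi> id X)"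
  proof (induction rule: psd_induct)
    case zero
    have "tensor_map \<psi> id (0 :: complex^('n \<times> 'k)^('n \<times> 'k)) = 0"
      by (simp add: vec_eq_iff tensor_map_id_nth)
    then show ?case by (simp only: psd_0)
  next
    case (add x B)
    have "psd (tensor_map \<psi> id (outer x))"
      unfolding psd_def
    proof (intro conjI allI)
      have "cnj (tensor_map \<psi> id (outer x) $ (q, t) $ (p, s)) = tensor_map \<psi> id (outer x) $ (p, s) $ (q, t)"
        for p q s t
        unfolding tensor_map_id_nth by (subst sum.swap) (simp add: herm mult_ac)
      then show "adj (tensor_map \<psi> id (outer x)) = tensor_map \<psi> id (outer x)"
        by (simp add: vec_eq_iff)
      show "0 \<le> Re (cinner y (tensor_map \<psi> id (outer x) *v y))" for y
        unfolding tensor_map_id_outer_form by (rule form) simp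
    qed
    then have "psd (tensor_map \<psi> id (outer x) + tensor_map \<psi> id B)"
      using add.IH by (rule psd_add)
    moreover have "tensor_map \<psi> id (outer x + B) = tensor_map \<psi> id (outer x) + tensor_map \<psi> id B"
      using linear_tensor_map unfolding complex_linear_iff by blast
    ultimately show ?case by (simp only:)
  qed
qed

section \<open>The maps Tr - r Ad\<close>

lemma complex_linear_trace_minus_Ad: "complex_linear (trace_minus_Ad r V)"
  by (simp add: complex_linear_iff trace_minus_Ad_def Ad_def vec_eq_iff mat_def trace_def
      matrix_matrix_mult_def sum.distrib sum_distrib_left sum_distrib_right algebra_simps)

text \<open>These are the entries of the Choi matrix: the identity, from the trace part, minus
  \<open>r\<close> times a matrix of rank at most one, from \<open>Ad V\<close>.\<close>

lemma trace_minus_Ad_mat_unit: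
  "trace_minus_Ad r V (mat_unit i j) $ p $ q
    = (if i = j \<and> p = q then 1 else 0) - of_real r * (V $ p $ i * cnj (V $ q $ j))"
proof -
  have tr: "trace (mat_unit i j) = (if i = j then 1 else 0 :: complex)"
  proof (cases "i = j")
    case True
    then show ?thesis by (simp add: trace_def)
  next
    case False
    then show ?thesis by (auto simp: trace_def intro!: sum.neutral)
  qed
  have "Ad V (mat_unit i j) $ p $ q = V $ p $ i * cnj (V $ q $ j)"
  proof -
    have "Ad V (mat_unit i j) $ p $ q
      = (\<Sum>b\<in>UNIV. (\<Sum>a\<in>UNIV. if a = i then if b = j then V $ p $ a else 0 else 0) * cnj (V $ q $ b))"
      unfolding Ad_def matrix_matrix_mult_def
      by (auto intro!: sum.cong simp del: sum.delta sum.delta')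
    also have "\<dots> = (\<Sum>b\<in>UNIV. if b = j then V $ p $ i * cnj (V $ q $ b) else 0)"
      by (intro sum.cong refl) simp
    finally show ?thesis by simp
  qed
  then show ?thesis
    by (simp add: trace_minus_Ad_def tr mat_def)
qed

text \<open>A rank-one kernel gives a squared modulus. This evaluates the contributions of
  \<open>Ad V\<close> and of its tensor square, and shows that they are nonnegative.\<close>

lemma sum_form_factor:
  fixes W F :: "'p \<Rightarrow> 'i \<Rightarrow> complex"
  shows "(\<Sum>p\<in>A. \<Sum>q\<in>A. \<Sum>i\<in>B. \<Sum>j\<in>B. W p i * cnj (W q j) * (F p i * cnj (F q j)))
    = of_real ((cmod (\<Sum>p\<in>A. \<Sum>i\<in>B. W p i * F p i))\<^sup>2)"
proof -
  have "of_real ((cmod (\<Sum>p\<in>A. \<Sum>i\<in>B. W p i * F p i))\<^sup>2)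
      = (\<Sum>p\<in>A. \<Sum>i\<in>B. W p i * F p i) * (\<Sum>q\<in>A. \<Sum>j\<in>B. cnj (W q j * F q j))"
    by (simp only: complex_norm_square cnj_sum)
  also have "\<dots> = (\<Sum>p\<in>A. \<Sum>q\<in>A. (\<Sum>i\<in>B. W p i * F p i) * (\<Sum>j\<in>B. cnj (W q j * F q j)))"
    by (simp only: sum_product)
  finally show ?thesis
    by (simp add: sum_product mult_ac)
qed

lemma sum_form_diag:
  fixes W :: "'p::finite \<Rightarrow> 'i::finite \<Rightarrow> complex"
  shows "(\<Sum>p\<in>UNIV. \<Sum>q\<in>UNIV. \<Sum>i\<in>UNIV. \<Sum>j\<in>UNIV. W p i * cnj (W q j) * (if i = j \<and> p = q then 1 else 0))
    = of_real (\<Sum>p\<in>UNIV. \<Sum>i\<in>UNIV. (cmod (W p i))\<^sup>2)"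
proof -
  have "(\<Sum>p\<in>UNIV. \<Sum>q\<in>UNIV. \<Sum>i\<in>UNIV. \<Sum>j\<in>UNIV. W p i * cnj (W q j) * (if i = j \<and> p = q then 1 else 0))
    = (\<Sum>p\<in>UNIV. \<Sum>q\<in>UNIV. if p = q then \<Sum>i\<in>UNIV. \<Sum>j\<in>UNIV. if i = j then W p i * cnj (W q j) else 0 else 0)"
    by (auto intro!: sum.cong simp del: sum.delta sum.delta')
  also have "\<dots> = (\<Sum>p\<in>UNIV. \<Sum>i\<in>UNIV. W p i * cnj (W p i))"
    by simp
  finally show ?thesis
    by (simp add: complex_norm_square del: of_real_power)
qed

text \<open>Applying the map to the rank-one operator of \<open>x\<close> and testing at
  \<open>V x\<close> gives \<open>r N^2 <= N |x|^2\<close>, where \<open>N\<close> is the squared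
  norm of \<open>V x\<close>. It remains to cancel \<open>N\<close>.\<close>

lemma positive_trace_minus_Ad_bound:
  fixes V :: "complex^'n^'n"
  assumes "k_positive TYPE(1) (trace_minus_Ad r V)"
  shows "r * (\<Sum>p\<in>UNIV. (cmod (\<Sum>i\<in>UNIV. V $ p $ i * x i))\<^sup>2) \<le> (\<Sum>i\<in>UNIV. (cmod (x i))\<^sup>2)"
proof -
  define w where "w p = (\<Sum>i\<in>UNIV. V $ p $ i * x i)" for p
  define N where "N = (\<Sum>p\<in>UNIV. (cmod (w p))\<^sup>2)"
  \<comment> \<open>The second coordinate ranges over a single index, so \<open>X\<close> and
    \<open>Y\<close> are just \<open>x\<close> and \<open>V x\<close>.\<close>
  define X :: "complex^('n \<times> 1)" where "X = (\<chi> a. x (fst a))"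
  define Y :: "complex^('n \<times> 1)" where "Y = (\<chi> a. w (fst a))"
  have "0 \<le> Re (cinner Y (tensor_map (trace_minus_Ad r V) id (outer X) *v Y))"
    using assms psd_outer[of X] unfolding k_positive_def positive_map_def psd_def by blast
  also have "cinner Y (tensor_map (trace_minus_Ad r V) id (outer X) *v Y)
      = of_real (\<Sum>p\<in>UNIV. \<Sum>i\<in>UNIV. (cmod (cnj (w p) * x i))\<^sup>2)
      - of_real r * of_real ((cmod (\<Sum>p\<in>UNIV. \<Sum>i\<in>UNIV. cnj (w p) * x i * V $ p $ i))\<^sup>2)"
    unfolding tensor_map_id_outer_form trace_minus_Ad_mat_unit sum_form_diag[symmetric] sum_form_factor[symmetric]
    by (simp add: X_def Y_def sum_distrib_left right_diff_distrib sum_subtractf mult_ac)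
  also have "(\<Sum>p\<in>UNIV. \<Sum>i\<in>UNIV. (cmod (cnj (w p) * x i))\<^sup>2) = N * (\<Sum>i\<in>UNIV. (cmod (x i))\<^sup>2)"
    by (simp add: N_def norm_mult power_mult_distrib sum_product)
  also have "(\<Sum>p\<in>UNIV. \<Sum>i\<in>UNIV. cnj (w p) * x i * V $ p $ i) = (\<Sum>p\<in>UNIV. w p * cnj (w p))"
  proof (intro sum.cong refl)
    fix p
    have "(\<Sum>i\<in>UNIV. cnj (w p) * x i * V $ p $ i) = (\<Sum>i\<in>UNIV. V $ p $ i * x i) * cnj (w p)"
      by (simp add: sum_distrib_left mult_ac)
    then show "(\<Sum>i\<in>UNIV. cnj (w p) * x i * V $ p $ i) = w p * cnj (w p)"
      by (simp only: w_def)
  qed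
  also have "\<dots> = of_real N"
    by (simp add: N_def complex_norm_square del: of_real_power)
  finally have *: "0 \<le> N * (\<Sum>i\<in>UNIV. (cmod (x i))\<^sup>2) - r * N\<^sup>2"
    by simp
  have "0 \<le> N"
    by (simp add: N_def sum_nonneg)
  have "r * N \<le> (\<Sum>i\<in>UNIV. (cmod (x i))\<^sup>2)"
  proof (cases "N = 0")
    case True
    then show ?thesis by (simp add: sum_nonneg)
  next
    case False
    have "N * (r * N) \<le> N * (\<Sum>i\<in>UNIV. (cmod (x i))\<^sup>2)"
      using * by (simp add: power2_eq_square mult_ac)
    then show ?thesis
      using False \<open>0 \<le> N\<close> by simp
  qed
  then show ?thesis by (simp add: N_def w_def)
qed

lemma tensor_map_mat_unit:
  assumes "complex_linear \<phi>" "complex_linear \<psi>"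
  shows "tensor_map \<phi> \<psi> (mat_unit (i, i') (j, j')) = kron (\<phi> (mat_unit i j)) (\<psi> (mat_unit i' j'))"
proof -
  have "mat_unit (i, i') (j, j') = kron (mat_unit i j) (mat_unit i' j')"
    by (auto simp: vec_eq_iff)
  then show ?thesis
    using assms by (simp add: tensor_map_kron)
qed

text \<open>This is the form of the trace map tensored with \<open>Ad F\<close>: the trace map
  identifies the first indices, leaving for each \<open>(p, i)\<close> a rank-one form in the second
  leg.\<close>

lemma sum_form_diag_left:
  fixes W :: "'p::finite \<times> 'q::finite \<Rightarrow> 'i::finite \<times> 'j::finite \<Rightarrow> complex"
  shows "(\<Sum>P\<in>UNIV. \<Sum>Q\<in>UNIV. \<Sum>I\<in>UNIV. \<Sum>J\<in>UNIV. W P I * cnj (W Q J)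
      * ((if fst I = fst J \<and> fst P = fst Q then 1 else 0) * (F (snd P) (snd I) * cnj (F (snd Q) (snd J)))))
    = of_real (\<Sum>p\<in>UNIV. \<Sum>i\<in>UNIV. (cmod (\<Sum>q\<in>UNIV. \<Sum>j\<in>UNIV. W (p, q) (i, j) * F q j))\<^sup>2)"
proof -
  let ?t = "\<lambda>p q p' q' i j i' j'. W (p, q) (i, j) * cnj (W (p', q') (i', j')) * (F q j * cnj (F q' j'))"
  have "(\<Sum>P\<in>UNIV. \<Sum>Q\<in>UNIV. \<Sum>I\<in>UNIV. \<Sum>J\<in>UNIV. W P I * cnj (W Q J)
      * ((if fst I = fst J \<and> fst P = fst Q then 1 else 0) * (F (snd P) (snd I) * cnj (F (snd Q) (snd J)))))
    = (\<Sum>p\<in>UNIV. \<Sum>q\<in>UNIV. \<Sum>p'\<in>UNIV. \<Sum>q'\<in>UNIV. \<Sum>i\<in>UNIV. \<Sum>j\<in>UNIV. \<Sum>i'\<in>UNIV. \<Sum>j'\<in>UNIV.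
        ?t p q p' q' i j i' j' * (if i = i' \<and> p = p' then 1 else 0))"
    unfolding sum_UNIV_prod by (simp add: mult_ac)
  also have "\<dots> = (\<Sum>p\<in>UNIV. \<Sum>q\<in>UNIV. \<Sum>p'\<in>UNIV. if p = p' then
      (\<Sum>q'\<in>UNIV. \<Sum>i\<in>UNIV. \<Sum>j\<in>UNIV. \<Sum>i'\<in>UNIV. if i = i' then \<Sum>j'\<in>UNIV. ?t p q p' q' i j i' j' else 0)
      else 0)"
    by (auto intro!: sum.cong simp del: sum.delta sum.delta')
  also have "\<dots> = (\<Sum>p\<in>UNIV. \<Sum>q\<in>UNIV. \<Sum>q'\<in>UNIV. \<Sum>i\<in>UNIV. \<Sum>j\<in>UNIV. \<Sum>j'\<in>UNIV. ?t p q p q' i j i j')"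
    by simp
  also have "\<dots> = (\<Sum>p\<in>UNIV. \<Sum>q\<in>UNIV. \<Sum>i\<in>UNIV. \<Sum>q'\<in>UNIV. \<Sum>j\<in>UNIV. \<Sum>j'\<in>UNIV. ?t p q p q' i j i j')"
    by (intro sum.cong refl sum.swap)
  also have "\<dots> = (\<Sum>p\<in>UNIV. \<Sum>i\<in>UNIV. \<Sum>q\<in>UNIV. \<Sum>q'\<in>UNIV. \<Sum>j\<in>UNIV. \<Sum>j'\<in>UNIV. ?t p q p q' i j i j')"
    by (intro sum.cong refl sum.swap)
  also have "\<dots> = (\<Sum>p\<in>UNIV. \<Sum>i\<in>UNIV. of_real ((cmod (\<Sum>q\<in>UNIV. \<Sum>j\<in>UNIV. W (p, q) (i, j) * F q j))\<^sup>2))"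
    by (subst sum_form_factor[of "\<lambda>q j. W (p, q) (i, j)" for p i, symmetric]) (rule refl)
  finally show ?thesis by simp
qed

lemma sum_sum_UNIV_swap:
  "(\<Sum>P\<in>UNIV. \<Sum>I\<in>UNIV. f P I) = (\<Sum>P\<in>UNIV. \<Sum>I\<in>UNIV. f (prod.swap P) (prod.swap I))"
  for f :: "'p::finite \<times> 'q::finite \<Rightarrow> 'i::finite \<times> 'j::finite \<Rightarrow> 'a::comm_monoid_add"
proof -
  have "(\<Sum>P\<in>UNIV. g P) = (\<Sum>P\<in>UNIV. g (prod.swap P))"
    for g :: "'x::finite \<times> 'y::finite \<Rightarrow> 'a"
    by (rule sum.reindex_bij_betw[OF bij_swap, symmetric])
  note swap = this
  show ?thesis
    by (rule trans[OF swap], rule sum.cong[OF refl], rule swap)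
qed

text \<open>Exchanging the two tensor factors reduces this to
  \<open>sum_form_diag_left\<close>.\<close>

lemma sum_form_diag_right:
  fixes W :: "'p::finite \<times> 'q::finite \<Rightarrow> 'i::finite \<times> 'j::finite \<Rightarrow> complex"
  shows "(\<Sum>P\<in>UNIV. \<Sum>Q\<in>UNIV. \<Sum>I\<in>UNIV. \<Sum>J\<in>UNIV. W P I * cnj (W Q J)
      * ((if snd I = snd J \<and> snd P = snd Q then 1 else 0) * (F (fst P) (fst I) * cnj (F (fst Q) (fst J)))))
    = of_real (\<Sum>q\<in>UNIV. \<Sum>j\<in>UNIV. (cmod (\<Sum>p\<in>UNIV. \<Sum>i\<in>UNIV. W (p, q) (i, j) * F p i))\<^sup>2)"
proof -
  let ?t = "\<lambda>P Q I J. W P I * cnj (W Q J)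
      * ((if snd I = snd J \<and> snd P = snd Q then 1 else 0) * (F (fst P) (fst I) * cnj (F (fst Q) (fst J))))"
  have "(\<Sum>P\<in>UNIV. \<Sum>Q\<in>UNIV. \<Sum>I\<in>UNIV. \<Sum>J\<in>UNIV. ?t P Q I J)
      = (\<Sum>P\<in>UNIV. \<Sum>Q\<in>UNIV. \<Sum>I\<in>UNIV. \<Sum>J\<in>UNIV. ?t (prod.swap P) (prod.swap Q) (prod.swap I) (prod.swap J))"
    by (rule trans[OF sum_sum_UNIV_swap], intro sum.cong[OF refl], rule sum_sum_UNIV_swap)
  also have "\<dots> = of_real (\<Sum>q\<in>UNIV. \<Sum>j\<in>UNIV. (cmod (\<Sum>p\<in>UNIV. \<Sum>i\<in>UNIV. W (p, q) (i, j) * F p i))\<^sup>2)"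
    using sum_form_diag_left[of "\<lambda>P I. W (prod.swap P) (prod.swap I)" F]
    by (simp only: fst_swap snd_swap swap_simp)
  finally show ?thesis .
qed

section \<open>Assembly of the four terms of the tensor square\<close>

theorem corollary7:
  fixes V :: "complex^'n^'n" and r :: real
  assumes "hs_norm V = 1"
    and "r > 0"
    and "k_positive TYPE(1) (trace_minus_Ad (4 * r) V)"
  shows "k_positive TYPE(2) (tensor_map (trace_minus_Ad r V) (trace_minus_Ad r V))"
proof (rule k_positiveI)
  let ?\<phi> = "trace_minus_Ad r V"
  have unit: "tensor_map ?\<phi> ?\<phi> (mat_unit I J) $ P $ Q
      = ?\<phi> (mat_unit (fst I) (fst J)) $ fst P $ fst Q * ?\<phi> (mat_unit (snd I) (snd J)) $ snd P $ snd Q"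
    for I J P Q
    using tensor_map_mat_unit[OF complex_linear_trace_minus_Ad complex_linear_trace_minus_Ad,
        of r V r V "fst I" "snd I" "fst J" "snd J"]
    by simp
  show "complex_linear (tensor_map ?\<phi> ?\<phi>)"
    by (rule linear_tensor_map)
  show "cnj (tensor_map ?\<phi> ?\<phi> (mat_unit I J) $ P $ Q) = tensor_map ?\<phi> ?\<phi> (mat_unit J I) $ Q $ P"
    for I J P Q
  proof -
    have "cnj (?\<phi> (mat_unit i j) $ p $ q) = ?\<phi> (mat_unit j i) $ q $ p" for i j p q
      unfolding trace_minus_Ad_mat_unit by (auto simp: mult.commute)
    then show ?thesis by (simp add: unit)
  qed
  fix a :: "2 \<Rightarrow> 'n \<times> 'n \<Rightarrow> complex" and b :: "2 \<Rightarrow> 'n \<times> 'n \<Rightarrow> complex"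
    and W :: "'n \<times> 'n \<Rightarrow> 'n \<times> 'n \<Rightarrow> complex"
  assume W: "W P I = (\<Sum>s\<in>UNIV. a s P * b s I)" for P I
  \<comment> \<open>\<open>S\<close>, \<open>C1\<close>, \<open>C2\<close> and \<open>D\<close> are
    the values at \<open>W\<close> of the forms of Tr x Tr, Ad x Tr, Tr x Ad and Ad x Ad, with x the
    tensor product.\<close>
  define S where "S = (\<Sum>P\<in>UNIV. \<Sum>I\<in>UNIV. (cmod (W P I))\<^sup>2)"
  define C1 where "C1 = (\<Sum>q\<in>UNIV. \<Sum>j\<in>UNIV. (cmod (\<Sum>p\<in>UNIV. \<Sum>i\<in>UNIV. W (p, q) (i, j) * V $ p $ i))\<^sup>2)"
  define C2 where "C2 = (\<Sum>p\<in>UNIV. \<Sum>i\<in>UNIV. (cmod (\<Sum>q\<in>UNIV. \<Sum>j\<in>UNIV. W (p, q) (i, j) * V $ q $ j))\<^sup>2)"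
  define D where "D = (cmod (\<Sum>P\<in>UNIV. \<Sum>I\<in>UNIV. W P I * (V $ fst P $ fst I * V $ snd P $ snd I)))\<^sup>2"
  have bound: "(\<Sum>p\<in>UNIV. (cmod (\<Sum>i\<in>UNIV. V $ p $ i * x i))\<^sup>2) \<le> 1 / (4 * r) * (\<Sum>i\<in>UNIV. (cmod (x i))\<^sup>2)"
    for x
    using positive_trace_minus_Ad_bound[OF assms(3), of x] \<open>r > 0\<close> by (simp add: field_simps)
  \<comment> \<open>The hypothesis bounds the squared operator norm of \<open>V\<close> by
    \<open>1 / (4 * r)\<close>; the rank-two factor 2 leaves \<open>1 / (2 * r)\<close>.\<close>
  have "C1 \<le> 2 * (1 / (4 * r)) * S"
    unfolding C1_def S_def by (rule contraction_rank_two_le[OF bound]) (simp add: W sum_2)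
  then have C1: "2 * r * C1 \<le> S"
    using \<open>r > 0\<close> by (simp add: field_simps)
  \<comment> \<open>\<open>C2\<close> contracts the second leg, so the same bound is applied to
    \<open>W\<close> with its legs exchanged.\<close>
  have "C2 \<le> 2 * (1 / (4 * r)) * (\<Sum>P\<in>UNIV. \<Sum>I\<in>UNIV. (cmod (W (prod.swap P) (prod.swap I)))\<^sup>2)"
    unfolding C2_def
    using contraction_rank_two_le[OF bound, where W = "\<lambda>P I. W (prod.swap P) (prod.swap I)"
        and a = "\<lambda>P. a 1 (prod.swap P)" and b = "\<lambda>I. b 1 (prod.swap I)"
        and a' = "\<lambda>P. a 2 (prod.swap P)" and b' = "\<lambda>I. b 2 (prod.swap I)"]
    by (simp add: W sum_2)
  also have "\<dots> = 2 * (1 / (4 * r)) * S"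
    unfolding S_def sum_sum_UNIV_swap[of "\<lambda>P I. (cmod (W P I))\<^sup>2"] ..
  finally have C2: "2 * r * C2 \<le> S"
    using \<open>r > 0\<close> by (simp add: field_simps)
  have entry: "tensor_map ?\<phi> ?\<phi> (mat_unit I J) $ P $ Q
      = (if I = J \<and> P = Q then 1 else 0)
      - of_real r * ((if snd I = snd J \<and> snd P = snd Q then 1 else 0)
          * (V $ fst P $ fst I * cnj (V $ fst Q $ fst J)))
      - of_real r * ((if fst I = fst J \<and> fst P = fst Q then 1 else 0)
          * (V $ snd P $ snd I * cnj (V $ snd Q $ snd J)))
      + of_real (r\<^sup>2) * (V $ fst P $ fst I * V $ snd P $ snd I
          * cnj (V $ fst Q $ fst J * V $ snd Q $ snd J))" for I J P Q
  proof -
    have "(d - of_real r * (v * v')) * (e - of_real r * (w * w')) = d * e - of_real r * (e * (v * v'))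
        - of_real r * (d * (w * w')) + of_real (r\<^sup>2) * (v * w * (v' * w'))" for d e v v' w w' :: complex
      by (simp add: algebra_simps power2_eq_square)
    moreover have "(if I = J \<and> P = Q then 1 else 0 :: complex)
        = (if fst I = fst J \<and> fst P = fst Q then 1 else 0) * (if snd I = snd J \<and> snd P = snd Q then 1 else 0)"
      by (auto simp: prod_eq_iff)
    ultimately show ?thesis
      unfolding unit trace_minus_Ad_mat_unit complex_cnj_mult by (simp only:)
  qed
  have distrib: "x * (d - of_real r * c - of_real r * c' + of_real (r\<^sup>2) * e)
      = x * d - of_real r * (x * c) - of_real r * (x * c') + of_real (r\<^sup>2) * (x * e)" for x d c c' e :: complex
    by (simp add: algebra_simps)
  have "(\<Sum>P\<in>UNIV. \<Sum>Q\<in>UNIV. \<Sum>I\<in>UNIV. \<Sum>J\<in>UNIV.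
      W P I * cnj (W Q J) * tensor_map ?\<phi> ?\<phi> (mat_unit I J) $ P $ Q)
    = of_real S - of_real r * of_real C1 - of_real r * of_real C2 + of_real (r\<^sup>2) * of_real D"
    unfolding entry distrib sum.distrib sum_subtractf sum_distrib_left[symmetric]
    unfolding sum_form_diag sum_form_diag_right[of W "\<lambda>p i. V $ p $ i"]
      sum_form_diag_left[of W "\<lambda>p i. V $ p $ i"]
      sum_form_factor[of W "\<lambda>P I. V $ fst P $ fst I * V $ snd P $ snd I"]
      S_def C1_def C2_def D_def ..
  \<comment> \<open>Each of \<open>r * C1\<close> and \<open>r * C2\<close> is at most half of
    \<open>S\<close>, and the completely positive term \<open>r\<^sup>2 * D\<close> is
    nonnegative.\<close>
  moreover have "0 \<le> S - r * C1 - r * C2 + r\<^sup>2 * D"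
    using C1 C2 by (simp add: D_def)
  ultimately show "0 \<le> Re (\<Sum>P\<in>UNIV. \<Sum>Q\<in>UNIV. \<Sum>I\<in>UNIV. \<Sum>J\<in>UNIV.
      W P I * cnj (W Q J) * tensor_map ?\<phi> ?\<phi> (mat_unit I J) $ P $ Q)"
    by simp
qed

end
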